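(* Let $n$ be even, and let the solution $\phi$ of $$\Box\phi+\frac{n(n+2)}{(1+x^2)^2}\,\phi=0$$ be written in the form $$\phi=\sum_{r=0}^{n/2}P_r(x)\,\frac{1}{(1+x^2)^r},$$ where $\Box P_r=0$ for every $0\le r\le\frac n2$. Then the coefficients $P_r$ obey the recursion relation $$P_r=\frac{2(r+1)\,[\,2H+(n-2r-4)\,]\,P_{r+1}}{(n-2r)(n+2r+2)},\qquad 0\le r\le\tfrac n2-1 .$$
   Context: Here $x\in\mathbf{M}^n$, $n$-dimensional Minkowski space with metric of signature $(-,+,\dots,+)$; $x^2=x\cdot x$ is the square of $x$ in this metric, and $\Box=\nabla\cdot\nabla$ is its D'Alembertian. The homogeneity (Euler) operator is $H=x\cdot\nabla=\sum_\mu x^\mu\partial_\mu$. *)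

theory Defs
  imports "HOL-Analysis.Analysis"
begin

text \<open>
  Minkowski space of dimension \<open>CARD('n)\<close> is \<^typ>\<open>real ^ 'n\<close> with a distinguished time
  index \<open>t :: 'n\<close>.
\<close>

definition eta :: "'n \<Rightarrow> 'n \<Rightarrow> real" where
  "eta t i = (if i = t then - 1 else 1)"

definition mink_inner :: "'n::finite \<Rightarrow> real ^ 'n \<Rightarrow> real ^ 'n \<Rightarrow> real" where
  "mink_inner t x y = (\<Sum>i\<in>UNIV. eta t i * x $ i * y $ i)"

definition mink_sq :: "'n::finite \<Rightarrow> real ^ 'n \<Rightarrow> real" where
  "mink_sq t x = mink_inner t x x"

definition partial_deriv :: "'n::finite \<Rightarrow> (real ^ 'n \<Rightarrow> real) \<Rightarrow> real ^ 'n \<Rightarrow> real" where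
  "partial_deriv i f x = frechet_derivative f (at x) (axis i 1)"

text \<open>
  Raising the index of a partial derivative uses the inverse metric, which has the same
  diagonal entries \<^const>\<open>eta\<close>.
\<close>

definition dalembertian :: "'n::finite \<Rightarrow> (real ^ 'n \<Rightarrow> real) \<Rightarrow> real ^ 'n \<Rightarrow> real" where
  "dalembertian t f x = (\<Sum>i\<in>UNIV. eta t i * partial_deriv i (partial_deriv i f) x)"

text \<open>
  In \<open>x \<cdot> \<nabla>\<close> the metric cancels against its inverse, so the Euler operator does not
  depend on the time index.
\<close>

definition euler :: "(real ^ 'n::finite \<Rightarrow> real) \<Rightarrow> real ^ 'n \<Rightarrow> real" where
  "euler f x = (\<Sum>i\<in>UNIV. x $ i * partial_deriv i f x)"

text \<open>
  Smoothness on an open set: all iterated partial derivatives are (Frechet) differentiable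
  there. This is only meant for open sets, since \<^const>\<open>partial_deriv\<close> uses unrestricted derivatives.
\<close>

definition smooth_on :: "(real ^ 'n::finite) set \<Rightarrow> (real ^ 'n \<Rightarrow> real) \<Rightarrow> bool" where
  "smooth_on S f \<longleftrightarrow> (\<forall>is. foldr partial_deriv is f differentiable_on S)"

end

theory Submission imports Defs "HOL-Real_Asymp.Real_Asymp" begin

text \<open>
  Write \<open>s = 1 + x\<^sup>2\<close>. For harmonic \<open>P\<close> the left-hand side of the equation applied to
  \<open>P / s^r\<close> is a combination of \<open>1 / s^(r+1)\<close> and \<open>1 / s^(r+2)\<close> whose coefficients are again
  harmonic, because \<open>\<box> H = H \<box> + 2 \<box>\<close>; the factor \<open>(n - 2r)(n + 2r + 2)\<close> of \<open>P / s^(r+2)\<close>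
  vanishes at \<open>r = n/2\<close>. Clearing denominators leaves \<open>\<Sum>\<^sub>k s^k T\<^sub>k = 0\<close> with harmonic \<open>T\<^sub>k\<close>,
  and it remains to see that all \<open>T\<^sub>k\<close> vanish. Applying \<open>\<box>\<close> lowers the degree in \<open>s\<close> and turns
  the leading coefficient \<open>T\<^sub>m\<close> into \<open>2m (2H + n + 2(m - 1)) T\<^sub>m\<close>, so \<open>T\<^sub>m = 0\<close> follows by
  induction, since \<open>2H + c\<close> with \<open>c > 0\<close> is injective on a domain that is star-shaped about 0.
\<close>

subsection \<open>Partial derivatives\<close>

lemma partial_deriv_eq:
  "(f has_derivative f') (at x) \<Longrightarrow> partial_deriv i f x = f' (axis i 1)"
  by (simp add: partial_deriv_def frechet_derivative_at [symmetric])

text \<open>No differentiability is required: \<open>frechet_derivative\<close> chooses from the set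
  of derivatives at \<open>x\<close>, and functions that agree near \<open>x\<close> have the same
  set, so the choice is the same.\<close>

lemma partial_deriv_cong:
  assumes "open S" "x \<in> S" "\<And>y. y \<in> S \<Longrightarrow> f y = g y"
  shows "partial_deriv i f x = partial_deriv i g x"
proof -
  have "(f has_derivative f') (at x) \<longleftrightarrow> (g has_derivative f') (at x)" for f'
    using assms has_derivative_transform_within_open [of f f' x UNIV S g]
      has_derivative_transform_within_open [of g f' x UNIV S f] by auto
  then show ?thesis by (simp add: partial_deriv_def frechet_derivative_def)
qed

lemma partial_deriv_const: "partial_deriv i (\<lambda>x. c) x = 0"
  by (simp add: partial_deriv_def)

lemma partial_deriv_coord:
  "partial_deriv i (\<lambda>x. x $ k) x = (if i = k then 1 else 0)"
  by (subst partial_deriv_eq [OF bounded_linear_imp_has_derivative [OF bounded_linear_vec_nth]])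
    (auto simp: axis_def)

lemma partial_deriv_add:
  assumes "f differentiable at x" "g differentiable at x"
  shows "partial_deriv i (\<lambda>x. f x + g x) x = partial_deriv i f x + partial_deriv i g x"
  using partial_deriv_eq [OF has_derivative_add [OF assms [unfolded frechet_derivative_works]]]
  by (simp add: partial_deriv_def)

lemma partial_deriv_mult:
  assumes "f differentiable at x" "g differentiable at x"
  shows "partial_deriv i (\<lambda>x. f x * g x) x = f x * partial_deriv i g x + partial_deriv i f x * g x"
  using partial_deriv_eq [OF has_derivative_mult [OF assms [unfolded frechet_derivative_works]]]
  by (simp add: partial_deriv_def)

lemma frechet_derivative_eq_sum_partial:
  assumes "f differentiable at x"
  shows "frechet_derivative f (at x) v = (\<Sum>i\<in>UNIV. v $ i * partial_deriv i f x)"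
proof -
  have lin: "linear (frechet_derivative f (at x))"
    by (rule linear_frechet_derivative [OF assms])
  have "frechet_derivative f (at x) v = frechet_derivative f (at x) (\<Sum>i\<in>UNIV. v $ i *\<^sub>R axis i 1)"
    using basis_expansion [of v] by (simp add: scalar_mult_eq_scaleR)
  then show ?thesis
    by (simp add: linear_sum [OF lin] linear_scale [OF lin] partial_deriv_def)
qed

section \<open>Symmetry of mixed second partial derivatives\<close>

lemma has_real_derivative_along_axis:
  assumes "f differentiable at (x + s *\<^sub>R axis i 1)"
  shows "((\<lambda>s. f (x + s *\<^sub>R axis i 1)) has_real_derivative
           partial_deriv i f (x + s *\<^sub>R axis i 1)) (at s)"
proof -
  let ?D = "frechet_derivative f (at (x + s *\<^sub>R axis i 1))"
  have D: "(f has_derivative ?D) (at (x + s *\<^sub>R axis i 1))"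
    using assms frechet_derivative_works by blast
  have "((\<lambda>s. x + s *\<^sub>R axis i 1) has_derivative (\<lambda>h. h *\<^sub>R axis i 1)) (at s)"
    by (auto intro!: derivative_eq_intros)
  from has_derivative_compose [OF this D]
  have "((\<lambda>s. f (x + s *\<^sub>R axis i 1)) has_derivative (\<lambda>h. ?D (h *\<^sub>R axis i 1))) (at s)" .
  moreover have "?D (h *\<^sub>R axis i 1) = partial_deriv i f (x + s *\<^sub>R axis i 1) * h" for h
    using linear_scale [OF linear_frechet_derivative [OF assms]]
    by (simp add: partial_deriv_def)
  ultimately show ?thesis by (simp add: has_field_derivative_def)
qed

text \<open>Two mean value arguments: one along axis \<open>i\<close> for the increment of
  \<open>f\<close> in direction \<open>j\<close>, then one along axis \<open>j\<close> for
  \<open>partial_deriv i f\<close>. The second difference is symmetric in \<open>i\<close> and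
  \<open>j\<close> while the right-hand side singles out an order, which is what makes the two
  orders comparable.\<close>

lemma second_difference_mvt:
  assumes f: "f differentiable_on S" and fi: "partial_deriv i f differentiable_on S"
    and S: "open S" "ball x r \<subseteq> S" and h: "0 < h" "2 * h < r"
  shows "\<exists>y \<in> ball x (2 * h).
    f (x + h *\<^sub>R axis i 1 + h *\<^sub>R axis j 1) - f (x + h *\<^sub>R axis i 1) - f (x + h *\<^sub>R axis j 1) + f x
      = h\<^sup>2 * partial_deriv j (partial_deriv i f) y"
proof -
  have dist_add: "dist x (x + a *\<^sub>R axis i 1 + b *\<^sub>R axis j 1) \<le> a + b"
    if "0 \<le> a" "0 \<le> b" for a b
    using norm_triangle_ineq [of "a *\<^sub>R axis i (1::real)" "b *\<^sub>R axis j 1"] that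
      norm_minus_cancel [of "a *\<^sub>R axis i (1::real) + b *\<^sub>R axis j 1"]
    by (simp add: dist_norm algebra_simps)
  have near: "x + a *\<^sub>R axis i 1 + b *\<^sub>R axis j 1 \<in> ball x (2 * h)"
    if "0 \<le> a" "a \<le> h" "0 \<le> b" "b \<le> h" "a + b < 2 * h" for a b
    using dist_add [of a b] that by simp
  \<comment> \<open>The far corner \<open>a = b = h\<close> has to be included, because
    \<open>MVT2\<close> asks for derivatives on closed intervals; this is where
    \<open>2 * h < r\<close> enters.\<close>
  have at: "g differentiable at (x + a *\<^sub>R axis i 1 + b *\<^sub>R axis j 1)"
    if "g differentiable_on S" "0 \<le> a" "a \<le> h" "0 \<le> b" "b \<le> h" for a b and g :: "real ^ 'a \<Rightarrow> real"
  proof -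
    have "x + a *\<^sub>R axis i 1 + b *\<^sub>R axis j 1 \<in> ball x r"
      using dist_add [of a b] that h by simp
    then show ?thesis
      using S that(1) at_within_open differentiable_on_def subsetD by metis
  qed
  have swap: "x + a *\<^sub>R axis j 1 + b *\<^sub>R axis i 1 = x + b *\<^sub>R axis i 1 + a *\<^sub>R axis j 1" for a b
    by simp
  let ?g = "\<lambda>s. f (x + h *\<^sub>R axis j 1 + s *\<^sub>R axis i 1) - f (x + s *\<^sub>R axis i 1)"
  let ?g' = "\<lambda>s. partial_deriv i f (x + h *\<^sub>R axis j 1 + s *\<^sub>R axis i 1)
                  - partial_deriv i f (x + s *\<^sub>R axis i 1)"
  have "(?g has_real_derivative ?g' s) (at s)" if "0 \<le> s" "s \<le> h" for s
    using at [OF f that, of h] at [OF f that, of 0] h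
    by (intro DERIV_diff has_real_derivative_along_axis) (simp_all add: swap)
  from MVT2 [OF h(1), of ?g ?g', OF this]
  obtain s where s: "0 < s" "s < h" "?g h - ?g 0 = h * ?g' s" by auto
  let ?k = "\<lambda>u. partial_deriv i f (x + s *\<^sub>R axis i 1 + u *\<^sub>R axis j 1)"
  let ?k' = "\<lambda>u. partial_deriv j (partial_deriv i f) (x + s *\<^sub>R axis i 1 + u *\<^sub>R axis j 1)"
  have "(?k has_real_derivative ?k' u) (at u)" if "0 \<le> u" "u \<le> h" for u
    using at [OF fi _ _ that, of s] s
    by (intro has_real_derivative_along_axis) simp_all
  from MVT2 [OF h(1), of ?k ?k', OF this]
  obtain u where u: "0 < u" "u < h" "?k h - ?k 0 = h * ?k' u" by auto
  \<comment> \<open>The first mean value is itself an increment of \<open>partial_deriv i f\<close>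
    along axis \<open>j\<close>, so the second one applies to it.\<close>
  have "?g' s = ?k h - ?k 0" by (simp add: swap)
  then have "?g h - ?g 0 = h\<^sup>2 * ?k' u" using s u by (simp add: power2_eq_square)
  moreover have near_su: "x + s *\<^sub>R axis i 1 + u *\<^sub>R axis j 1 \<in> ball x (2 * h)"
    using near s u by simp
  moreover have "?g h - ?g 0 = f (x + h *\<^sub>R axis i 1 + h *\<^sub>R axis j 1)
      - f (x + h *\<^sub>R axis i 1) - f (x + h *\<^sub>R axis j 1) + f x"
    by (simp add: swap)
  ultimately show ?thesis by (intro bexI [OF _ near_su]) simp
qed

lemma partial_deriv_commute:
  assumes S: "open S" "x \<in> S" and f: "f differentiable_on S"
    and fi: "partial_deriv i f differentiable_on S" and fj: "partial_deriv j f differentiable_on S"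
    and cij: "continuous_on S (partial_deriv i (partial_deriv j f))"
    and cji: "continuous_on S (partial_deriv j (partial_deriv i f))"
  shows "partial_deriv i (partial_deriv j f) x = partial_deriv j (partial_deriv i f) x"
    (is "?A x = ?B x")
proof -
  obtain r where r: "0 < r" "ball x r \<subseteq> S" using S openE by blast
  \<comment> \<open>The offset 2 makes \<open>2 * h 0 = r / 2\<close>, so the strict bound
    \<open>2 * h n < r\<close> holds from the first index on.\<close>
  define h where "h n = r / (2 * (real n + 2))" for n
  have h: "0 < h n" "2 * h n < r" for n
    using r by (auto simp: h_def field_simps intro: add_pos_nonneg)
  have h0: "h \<longlonglongrightarrow> 0" unfolding h_def by real_asymp
  \<comment> \<open>The same second difference is read in both orders. The mixed derivatives then
    agree at two possibly different points, both of which tend to \<open>x\<close>, and continuity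
    finishes the argument.\<close>
  have "\<exists>y z. y \<in> ball x (2 * h n) \<and> z \<in> ball x (2 * h n) \<and> ?A y = ?B z" for n
  proof -
    obtain z where z: "z \<in> ball x (2 * h n)"
      "f (x + h n *\<^sub>R axis i 1 + h n *\<^sub>R axis j 1) - f (x + h n *\<^sub>R axis i 1) - f (x + h n *\<^sub>R axis j 1) + f x
      = (h n)\<^sup>2 * ?B z"
      using second_difference_mvt [OF f fi S(1) r(2) h] by blast
    obtain y where y: "y \<in> ball x (2 * h n)"
      "f (x + h n *\<^sub>R axis j 1 + h n *\<^sub>R axis i 1) - f (x + h n *\<^sub>R axis j 1) - f (x + h n *\<^sub>R axis i 1) + f x
      = (h n)\<^sup>2 * ?A y"
      using second_difference_mvt [OF f fj S(1) r(2) h] by blast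
    have "(h n)\<^sup>2 * ?A y = (h n)\<^sup>2 * ?B z" using y z by (simp add: algebra_simps)
    with h(1) [of n] y(1) z(1) show ?thesis by auto
  qed
  then obtain Y Z where YZ: "\<And>n. Y n \<in> ball x (2 * h n)" "\<And>n. Z n \<in> ball x (2 * h n)"
    "\<And>n. ?A (Y n) = ?B (Z n)" by metis
  have conv: "W \<longlonglongrightarrow> x" if "\<And>n. W n \<in> ball x (2 * h n)" for W
  proof (rule metric_tendsto_imp_tendsto)
    show "(\<lambda>n. 2 * h n) \<longlonglongrightarrow> 0" using tendsto_mult_left [OF h0, of 2] by simp
    show "\<forall>\<^sub>F n in sequentially. dist (W n) x \<le> dist (2 * h n) 0"
      using that h by (auto simp: dist_commute less_imp_le)
  qed
  have "(\<lambda>n. ?A (Y n)) \<longlonglongrightarrow> ?A x" "(\<lambda>n. ?B (Z n)) \<longlonglongrightarrow> ?B x"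
    using continuous_on_eq_continuous_at [OF S(1)] cij cji S(2) conv [OF YZ(1)] conv [OF YZ(2)]
      isCont_tendsto_compose by blast+
  then show ?thesis using YZ(3) LIMSEQ_unique by simp
qed

subsection \<open>Smooth functions\<close>

lemma smooth_on_iff:
  "smooth_on S f \<longleftrightarrow> f differentiable_on S \<and> (\<forall>i. smooth_on S (partial_deriv i f))"
proof
  assume L: "smooth_on S f"
  show "f differentiable_on S \<and> (\<forall>i. smooth_on S (partial_deriv i f))"
  proof (intro conjI allI)
    show "f differentiable_on S" using L [unfolded smooth_on_def, rule_format, of "[]"] by simp
    \<comment> \<open>\<open>foldr\<close> applies the last entry of the list first, so
      differentiating \<open>f\<close> beforehand appends \<open>i\<close> at the end of the
      list.\<close>
    show "smooth_on S (partial_deriv i f)" for i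
      unfolding smooth_on_def
      using L [unfolded smooth_on_def, rule_format, of "_ @ [i]"] by simp
  qed
next
  assume R: "f differentiable_on S \<and> (\<forall>i. smooth_on S (partial_deriv i f))"
  have "foldr partial_deriv is f differentiable_on S" for "is"
    using R by (cases "is" rule: rev_cases) (auto simp: smooth_on_def)
  then show "smooth_on S f" by (simp add: smooth_on_def)
qed

lemma differentiable_on_cong:
  assumes "f differentiable_on S" "\<And>x. x \<in> S \<Longrightarrow> g x = f x"
  shows "g differentiable_on S"
  using assms has_derivative_transform unfolding differentiable_on_def differentiable_def by metis

text \<open>A class of differentiable functions that is closed under partial derivatives consists of
  smooth functions. Closure up to equality on \<open>S\<close> suffices, since on an open set such
  an equality passes to further derivatives.\<close>

lemma smooth_on_coinduct:
  assumes S: "open S" and X: "X f"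
    and step: "\<And>f. X f \<Longrightarrow> f differentiable_on S \<and> (\<forall>i. \<exists>g. X g \<and> (\<forall>x\<in>S. partial_deriv i f x = g x))"
  shows "smooth_on S f"
proof -
  have "\<exists>g. X g \<and> (\<forall>x\<in>S. foldr partial_deriv is f x = g x)" for "is"
  proof (induction "is")
    case Nil
    then show ?case using X by auto
  next
    case (Cons i "is")
    then obtain g where g: "X g" "\<forall>x\<in>S. foldr partial_deriv is f x = g x" by blast
    then obtain g' where "X g'" "\<forall>x\<in>S. partial_deriv i g x = g' x" using step by blast
    moreover have "partial_deriv i (foldr partial_deriv is f) x = partial_deriv i g x" if "x \<in> S" for x
      using partial_deriv_cong [OF S that] g by blast
    ultimately show ?case by auto
  qed
  then show ?thesis
    using step differentiable_on_cong unfolding smooth_on_def by metis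
qed

text \<open>The derivative of a product is a sum of products, so closure of smoothness under addition
  and multiplication is obtained simultaneously.\<close>

inductive smooth_alg :: "(real ^ 'n::finite) set \<Rightarrow> (real ^ 'n \<Rightarrow> real) \<Rightarrow> bool" for S where
  base: "smooth_on S f \<Longrightarrow> smooth_alg S f"
| add: "smooth_alg S f \<Longrightarrow> smooth_alg S g \<Longrightarrow> smooth_alg S (\<lambda>x. f x + g x)"
| mult: "smooth_alg S f \<Longrightarrow> smooth_alg S g \<Longrightarrow> smooth_alg S (\<lambda>x. f x * g x)"

lemma smooth_alg_step:
  assumes S: "open S" and f: "smooth_alg S f"
  shows "f differentiable_on S \<and> (\<forall>i. \<exists>g. smooth_alg S g \<and> (\<forall>x\<in>S. partial_deriv i f x = g x))"
  using f
proof induction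
  case (base f)
  then show ?case using smooth_on_iff smooth_alg.base by metis
next
  case (add f g)
  then have d: "f differentiable at x" "g differentiable at x" if "x \<in> S" for x
    using that S differentiable_on_eq_differentiable_at by blast+
  show ?case
  proof (intro conjI allI)
    show "(\<lambda>x. f x + g x) differentiable_on S" using add differentiable_on_add by blast
    fix i
    obtain f' g' where "smooth_alg S f'" "smooth_alg S g'"
      "\<forall>x\<in>S. partial_deriv i f x = f' x" "\<forall>x\<in>S. partial_deriv i g x = g' x"
      using add.IH by blast
    then show "\<exists>h. smooth_alg S h \<and> (\<forall>x\<in>S. partial_deriv i (\<lambda>x. f x + g x) x = h x)"
      using d by (intro exI [of _ "\<lambda>x. f' x + g' x"]) (simp add: smooth_alg.add partial_deriv_add)
  qed
next
  case (mult f g)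
  then have d: "f differentiable at x" "g differentiable at x" if "x \<in> S" for x
    using that S differentiable_on_eq_differentiable_at by blast+
  show ?case
  proof (intro conjI allI)
    show "(\<lambda>x. f x * g x) differentiable_on S" using mult differentiable_on_mult by blast
    fix i
    obtain f' g' where "smooth_alg S f'" "smooth_alg S g'"
      "\<forall>x\<in>S. partial_deriv i f x = f' x" "\<forall>x\<in>S. partial_deriv i g x = g' x"
      using mult.IH by blast
    then show "\<exists>h. smooth_alg S h \<and> (\<forall>x\<in>S. partial_deriv i (\<lambda>x. f x * g x) x = h x)"
      using d mult.hyps by (intro exI [of _ "\<lambda>x. f x * g' x + f' x * g x"])
        (simp add: smooth_alg.intros partial_deriv_mult)
  qed
qed

lemma smooth_alg_imp_smooth_on: "open S \<Longrightarrow> smooth_alg S f \<Longrightarrow> smooth_on S f"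
  by (rule smooth_on_coinduct [where X = "smooth_alg S", OF _ _ smooth_alg_step])

lemma smooth_on_add:
  assumes "open S" "smooth_on S f" "smooth_on S g"
  shows "smooth_on S (\<lambda>x. f x + g x)"
  using assms by (simp add: smooth_alg_imp_smooth_on smooth_alg.base smooth_alg.add)

lemma smooth_on_mult:
  assumes "open S" "smooth_on S f" "smooth_on S g"
  shows "smooth_on S (\<lambda>x. f x * g x)"
  using assms by (simp add: smooth_alg_imp_smooth_on smooth_alg.base smooth_alg.mult)

lemma smooth_on_const:
  assumes "open S"
  shows "smooth_on S (\<lambda>x. c)"
proof (rule smooth_on_coinduct [OF assms, where X = "\<lambda>f. \<exists>c. f = (\<lambda>x. c)"])
  fix f :: "real ^ 'a \<Rightarrow> real" assume "\<exists>c. f = (\<lambda>x. c)"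
  then have "f differentiable_on S" "\<forall>x\<in>S. partial_deriv i f x = (\<lambda>x. 0) x" for i
    by (auto simp: partial_deriv_const)
  then show "f differentiable_on S \<and>
      (\<forall>i. \<exists>g. (\<exists>c. g = (\<lambda>x. c)) \<and> (\<forall>x\<in>S. partial_deriv i f x = g x))" by blast
qed auto

lemma smooth_on_coord:
  assumes "open S"
  shows "smooth_on S (\<lambda>x. x $ k)"
proof -
  have "partial_deriv i (\<lambda>x. x $ k) = (\<lambda>x. if i = k then 1 else 0)" for i
    by (simp add: fun_eq_iff partial_deriv_coord)
  then show ?thesis
    unfolding smooth_on_iff [of S "\<lambda>x. x $ k"]
    by (simp add: smooth_on_const [OF assms] bounded_linear_imp_differentiable_on [OF bounded_linear_vec_nth])
qed

lemma smooth_on_sum: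
  assumes "open S" "finite A" "\<And>i. i \<in> A \<Longrightarrow> smooth_on S (f i)"
  shows "smooth_on S (\<lambda>x. \<Sum>i\<in>A. f i x)"
  using assms(2,3)
  by (induction A rule: finite_induct) (simp_all add: assms(1) smooth_on_const smooth_on_add)

lemma smooth_on_partial_deriv: "smooth_on S f \<Longrightarrow> smooth_on S (partial_deriv i f)"
  using smooth_on_iff by blast

lemma smooth_on_imp_differentiable_on: "smooth_on S f \<Longrightarrow> f differentiable_on S"
  using smooth_on_iff by blast

lemma smooth_on_euler: "open S \<Longrightarrow> smooth_on S f \<Longrightarrow> smooth_on S (euler f)"
  unfolding euler_def [abs_def]
  by (intro smooth_on_sum smooth_on_mult smooth_on_coord smooth_on_partial_deriv finite)

lemma smooth_on_partial_deriv_commute: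
  assumes "open S" "smooth_on S f" "x \<in> S"
  shows "partial_deriv i (partial_deriv j f) x = partial_deriv j (partial_deriv i f) x"
  by (rule partial_deriv_commute [OF assms(1,3)])
    (simp_all add: smooth_on_imp_differentiable_on differentiable_imp_continuous_on
      smooth_on_partial_deriv assms)

subsection \<open>The d'Alembertian and the Euler operator\<close>

text \<open>The regularity that the rules for \<open>dalembertian\<close> need. With it, negative
  powers of \<open>1 + mink_sq t x\<close> can be treated by two explicit derivatives instead of a
  proof that they are smooth.\<close>

definition twice_differentiable_on ::
  "(real ^ 'n::finite \<Rightarrow> real) \<Rightarrow> (real ^ 'n) set \<Rightarrow> bool" (infixr "twice'_differentiable'_on" 50) where
  "f twice_differentiable_on S \<longleftrightarrow>
     f differentiable_on S \<and> (\<forall>i. partial_deriv i f differentiable_on S)"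

lemma smooth_on_imp_twice_differentiable_on: "smooth_on S f \<Longrightarrow> f twice_differentiable_on S"
  by (simp add: twice_differentiable_on_def smooth_on_imp_differentiable_on smooth_on_partial_deriv)

lemma twice_differentiable_onD:
  assumes "f twice_differentiable_on S" "open S" "x \<in> S"
  shows "f differentiable at x" "partial_deriv i f differentiable at x"
  using assms by (auto simp: twice_differentiable_on_def differentiable_on_eq_differentiable_at)

lemma twice_differentiable_on_subset:
  "f twice_differentiable_on S \<Longrightarrow> U \<subseteq> S \<Longrightarrow> f twice_differentiable_on U"
  by (meson twice_differentiable_on_def differentiable_on_subset)

lemma dalembertian_cong:
  assumes "open S" "x \<in> S" "\<And>y. y \<in> S \<Longrightarrow> f y = g y"
  shows "dalembertian t f x = dalembertian t g x"
  unfolding dalembertian_def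
  by (intro sum.cong refl arg_cong2 [where f = "(*)"] partial_deriv_cong [OF assms(1,2)]
      partial_deriv_cong [OF assms(1)] assms(3))

lemma euler_cong:
  assumes "open S" "x \<in> S" "\<And>y. y \<in> S \<Longrightarrow> f y = g y"
  shows "euler f x = euler g x"
  unfolding euler_def
  by (intro sum.cong refl arg_cong2 [where f = "(*)"] partial_deriv_cong [OF assms(1,2)] assms(3))

lemma dalembertian_const: "dalembertian t (\<lambda>x. c) x = 0"
proof -
  have "partial_deriv i (\<lambda>x. c) = (\<lambda>x. 0)" for i :: 'a
    by (simp add: fun_eq_iff partial_deriv_const)
  then show ?thesis by (simp add: dalembertian_def partial_deriv_const)
qed

lemma dalembertian_coord: "dalembertian t (\<lambda>x. x $ k) x = 0"
proof -
  have "partial_deriv i (\<lambda>x. x $ k) = (\<lambda>x. if i = k then 1 else 0)" for i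
    by (simp add: fun_eq_iff partial_deriv_coord)
  then show ?thesis by (simp add: dalembertian_def partial_deriv_const)
qed

section \<open>Product rules and commutation relations for the d'Alembertian\<close>

lemma
  assumes S: "open S" and f: "f twice_differentiable_on S" and g: "g twice_differentiable_on S"
  shows twice_differentiable_on_add: "(\<lambda>x. f x + g x) twice_differentiable_on S"
    and dalembertian_add: "x \<in> S \<Longrightarrow>
      dalembertian t (\<lambda>x. f x + g x) x = dalembertian t f x + dalembertian t g x"
proof -
  note d = twice_differentiable_onD [OF f S] twice_differentiable_onD [OF g S]
  have 1: "partial_deriv i (\<lambda>x. f x + g x) x = partial_deriv i f x + partial_deriv i g x"
    if "x \<in> S" for i x
    using d that by (simp add: partial_deriv_add)
  show "(\<lambda>x. f x + g x) twice_differentiable_on S"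
    unfolding twice_differentiable_on_def
  proof (intro conjI allI)
    show "(\<lambda>x. f x + g x) differentiable_on S"
      using f g by (simp add: twice_differentiable_on_def)
    fix i
    have "(\<lambda>x. partial_deriv i f x + partial_deriv i g x) differentiable_on S"
      using f g by (simp add: twice_differentiable_on_def)
    then show "partial_deriv i (\<lambda>x. f x + g x) differentiable_on S"
      by (rule differentiable_on_cong) (rule 1)
  qed
  assume x: "x \<in> S"
  have "partial_deriv i (partial_deriv i (\<lambda>x. f x + g x)) x
      = partial_deriv i (partial_deriv i f) x + partial_deriv i (partial_deriv i g) x" for i
    using partial_deriv_cong [OF S x 1] d x by (simp add: partial_deriv_add)
  then show "dalembertian t (\<lambda>x. f x + g x) x = dalembertian t f x + dalembertian t g x"
    by (simp add: dalembertian_def sum.distrib algebra_simps)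
qed

lemma
  assumes S: "open S" and f: "f twice_differentiable_on S" and g: "g twice_differentiable_on S"
  shows twice_differentiable_on_mult: "(\<lambda>x. f x * g x) twice_differentiable_on S"
    and dalembertian_mult: "x \<in> S \<Longrightarrow>
      dalembertian t (\<lambda>x. f x * g x) x = f x * dalembertian t g x
        + 2 * (\<Sum>i\<in>UNIV. eta t i * (partial_deriv i f x * partial_deriv i g x))
        + dalembertian t f x * g x"
proof -
  note d = twice_differentiable_onD [OF f S] twice_differentiable_onD [OF g S]
  \<comment> \<open>The first-order rule is needed on all of \<open>S\<close>, not just at one
    point, so that \<open>partial_deriv_cong\<close> can differentiate it once more.\<close>
  have 1: "partial_deriv i (\<lambda>x. f x * g x) x = f x * partial_deriv i g x + partial_deriv i f x * g x"
    if "x \<in> S" for i x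
    using d that by (simp add: partial_deriv_mult)
  show "(\<lambda>x. f x * g x) twice_differentiable_on S"
    unfolding twice_differentiable_on_def
  proof (intro conjI allI)
    show "(\<lambda>x. f x * g x) differentiable_on S"
      using f g by (simp add: twice_differentiable_on_def)
    fix i
    have "(\<lambda>x. f x * partial_deriv i g x + partial_deriv i f x * g x) differentiable_on S"
      using f g by (simp add: twice_differentiable_on_def)
    then show "partial_deriv i (\<lambda>x. f x * g x) differentiable_on S"
      by (rule differentiable_on_cong) (rule 1)
  qed
  assume x: "x \<in> S"
  have "partial_deriv i (partial_deriv i (\<lambda>x. f x * g x)) x
      = f x * partial_deriv i (partial_deriv i g) x + 2 * (partial_deriv i f x * partial_deriv i g x)
        + partial_deriv i (partial_deriv i f) x * g x" for i
    using partial_deriv_cong [OF S x 1] d x by (simp add: partial_deriv_add partial_deriv_mult)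
  then show "dalembertian t (\<lambda>x. f x * g x) x = f x * dalembertian t g x
        + 2 * (\<Sum>i\<in>UNIV. eta t i * (partial_deriv i f x * partial_deriv i g x))
        + dalembertian t f x * g x"
    by (simp add: dalembertian_def sum.distrib sum_distrib_left sum_distrib_right algebra_simps)
qed

lemma twice_differentiable_on_const: "(\<lambda>x. c) twice_differentiable_on S"
  using smooth_on_imp_twice_differentiable_on [OF smooth_on_const [OF open_UNIV]]
    twice_differentiable_on_subset by blast

lemma dalembertian_cmult:
  assumes "open S" "f twice_differentiable_on S" "x \<in> S"
  shows "dalembertian t (\<lambda>x. c * f x) x = c * dalembertian t f x"
  using dalembertian_mult [OF assms(1) twice_differentiable_on_const assms(2,3)]
  by (simp add: partial_deriv_const dalembertian_const)

lemma twice_differentiable_on_sum: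
  assumes "open S" "finite A" "\<And>k. k \<in> A \<Longrightarrow> f k twice_differentiable_on S"
  shows "(\<lambda>x. \<Sum>k\<in>A. f k x) twice_differentiable_on S"
  using assms(2,3)
  by (induction A rule: finite_induct)
    (simp_all add: twice_differentiable_on_const twice_differentiable_on_add [OF assms(1)])

lemma dalembertian_sum:
  assumes "open S" "finite A" "\<And>k. k \<in> A \<Longrightarrow> f k twice_differentiable_on S" "x \<in> S"
  shows "dalembertian t (\<lambda>x. \<Sum>k\<in>A. f k x) x = (\<Sum>k\<in>A. dalembertian t (f k) x)"
  using assms(2,3)
proof (induction A rule: finite_induct)
  case empty
  then show ?case by (simp add: dalembertian_const)
next
  case (insert a A)
  then show ?case
    using dalembertian_add [OF assms(1) _ twice_differentiable_on_sum [OF assms(1) insert.hyps(1)] assms(4)]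
    by simp
qed

lemma partial_deriv_sum:
  assumes "finite A" "\<And>k. k \<in> A \<Longrightarrow> f k differentiable at x"
  shows "partial_deriv i (\<lambda>x. \<Sum>k\<in>A. f k x) x = (\<Sum>k\<in>A. partial_deriv i (f k) x)"
  using assms
  by (induction A rule: finite_induct) (simp_all add: partial_deriv_const partial_deriv_add)

text \<open>The coefficients \<open>eta t i\<close> are constant, so it is enough to move
  \<open>k\<close> outward past two derivatives in direction \<open>i\<close>, one swap at a
  time.\<close>

lemma dalembertian_partial_deriv_commute:
  assumes S: "open S" and f: "smooth_on S f" and x: "x \<in> S"
  shows "dalembertian t (partial_deriv k f) x = partial_deriv k (dalembertian t f) x"
proof -
  have sm: "smooth_on S (partial_deriv i (partial_deriv i f))" for i
    by (intro smooth_on_partial_deriv f)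
  then have d: "partial_deriv i (partial_deriv i f) differentiable at x" for i
    using S x smooth_on_imp_differentiable_on differentiable_on_eq_differentiable_at by blast
  have "partial_deriv i (partial_deriv i (partial_deriv k f)) x
      = partial_deriv k (partial_deriv i (partial_deriv i f)) x" for i
  proof -
    have "partial_deriv i (partial_deriv i (partial_deriv k f)) x
        = partial_deriv i (partial_deriv k (partial_deriv i f)) x"
      by (rule partial_deriv_cong [OF S x]) (rule smooth_on_partial_deriv_commute [OF S f])
    also have "\<dots> = partial_deriv k (partial_deriv i (partial_deriv i f)) x"
      by (rule smooth_on_partial_deriv_commute [OF S smooth_on_partial_deriv [OF f] x])
    finally show ?thesis .
  qed
  moreover have "partial_deriv k (dalembertian t f) x
      = (\<Sum>i\<in>UNIV. eta t i * partial_deriv k (partial_deriv i (partial_deriv i f)) x)"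
    unfolding dalembertian_def [abs_def]
    using d by (subst partial_deriv_sum) (simp_all add: partial_deriv_mult partial_deriv_const)
  ultimately show ?thesis by (simp add: dalembertian_def)
qed

text \<open>The product rule is applied to each \<open>x $ k * partial_deriv k f x\<close>.
  Coordinates are harmonic, and the cross term keeps only the index \<open>k\<close>; summed over
  \<open>k\<close>, these cross terms give twice the d'Alembertian.\<close>

lemma dalembertian_euler:
  assumes S: "open S" and f: "smooth_on S f" and x: "x \<in> S"
  shows "dalembertian t (euler f) x = euler (dalembertian t f) x + 2 * dalembertian t f x"
proof -
  have tc: "(\<lambda>x. x $ k) twice_differentiable_on S" for k :: 'a
    by (intro smooth_on_imp_twice_differentiable_on smooth_on_coord S)
  have tp: "partial_deriv k f twice_differentiable_on S" for k
    by (intro smooth_on_imp_twice_differentiable_on smooth_on_partial_deriv f)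
  have "dalembertian t (euler f) x = (\<Sum>k\<in>UNIV. dalembertian t (\<lambda>x. x $ k * partial_deriv k f x) x)"
    unfolding euler_def [abs_def]
    by (rule dalembertian_sum [OF S finite _ x]) (intro twice_differentiable_on_mult S tc tp)
  also have "\<dots> = (\<Sum>k\<in>UNIV. x $ k * partial_deriv k (dalembertian t f) x
      + 2 * (eta t k * partial_deriv k (partial_deriv k f) x))"
    by (simp add: dalembertian_mult [OF S tc tp x] dalembertian_coord partial_deriv_coord
        dalembertian_partial_deriv_commute [OF S f x] mult_delta_left mult_delta_right)
  finally show ?thesis
    by (simp add: euler_def dalembertian_def [of t f x] sum.distrib sum_distrib_left)
qed

lemma harmonic_euler:
  assumes S: "open S" and f: "smooth_on S f" and x: "x \<in> S"
    and h: "\<And>y. y \<in> S \<Longrightarrow> dalembertian t f y = 0"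
  shows "dalembertian t (euler f) x = 0"
  using dalembertian_euler [OF S f x, of t] euler_cong [OF S x h] h [OF x]
  by (simp add: euler_def partial_deriv_const)

subsection \<open>Functions of the Minkowski square\<close>

lemma mink_sq_has_derivative:
  "(mink_sq t has_derivative (\<lambda>v. \<Sum>k\<in>UNIV. 2 * (eta t k * x $ k) * v $ k)) (at x)"
  unfolding mink_sq_def [abs_def] mink_inner_def [abs_def]
  by (auto intro!: derivative_eq_intros bounded_linear_imp_has_derivative bounded_linear_vec_nth
      simp: algebra_simps fun_eq_iff)

lemma eta_eta: "eta t i * eta t i = 1"
  by (simp add: eta_def)

text \<open>The gradient of \<open>x^2\<close> is \<open>2 x\<close>, its Minkowski square is
  \<open>4 x^2\<close>, and the d'Alembertian of \<open>x^2\<close> is twice the dimension.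
  Derivatives of \<open>F\<close> are required only at values attained by
  \<open>1 + mink_sq t x\<close> on \<open>S\<close>, so negative powers are covered wherever that
  value is nonzero.\<close>

lemma
  fixes F F' F'' :: "real \<Rightarrow> real" and t :: "'n::finite"
  assumes S: "open S"
    and F: "\<And>x. x \<in> S \<Longrightarrow> (F has_real_derivative F' (1 + mink_sq t x)) (at (1 + mink_sq t x))"
    and F': "\<And>x. x \<in> S \<Longrightarrow> (F' has_real_derivative F'' (1 + mink_sq t x)) (at (1 + mink_sq t x))"
  shows twice_differentiable_on_radial: "(\<lambda>x. F (1 + mink_sq t x)) twice_differentiable_on S"
    and partial_deriv_radial: "x \<in> S \<Longrightarrow>
      partial_deriv i (\<lambda>x. F (1 + mink_sq t x)) x = 2 * (eta t i * x $ i) * F' (1 + mink_sq t x)"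
    and dalembertian_radial: "x \<in> S \<Longrightarrow>
      dalembertian t (\<lambda>x. F (1 + mink_sq t x)) x
        = 4 * mink_sq t x * F'' (1 + mink_sq t x) + 2 * real CARD('n) * F' (1 + mink_sq t x)"
proof -
  \<comment> \<open>Stated for a general \<open>G\<close> because it is used both for
    \<open>F\<close> and for \<open>F'\<close>.\<close>
  have D: "((\<lambda>x. G (1 + mink_sq t x)) has_derivative
      (\<lambda>v. g * (\<Sum>k\<in>UNIV. 2 * (eta t k * x $ k) * v $ k))) (at x)"
    if "(G has_real_derivative g) (at (1 + mink_sq t x))" for G g x
    by (rule has_derivative_compose [where f = "\<lambda>x. 1 + mink_sq t x",
          OF _ that [unfolded has_field_derivative_def]])
      (auto intro!: derivative_eq_intros mink_sq_has_derivative)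
  have pd: "partial_deriv i (\<lambda>x. G (1 + mink_sq t x)) x = 2 * (eta t i * x $ i) * g"
    if "(G has_real_derivative g) (at (1 + mink_sq t x))" for G g x and i :: 'n
    by (subst partial_deriv_eq [OF D [OF that]])
      (simp add: axis_def if_distrib cong: if_cong)
  have dF: "(\<lambda>x. F (1 + mink_sq t x)) differentiable at x"
    and dF': "(\<lambda>x. F' (1 + mink_sq t x)) differentiable at x" if "x \<in> S" for x
    using D [OF F [OF that]] D [OF F' [OF that]] differentiableI by blast+
  have dc: "(\<lambda>x. 2 * (eta t i * x $ i)) differentiable at x" for i :: 'n and x
    by (intro derivative_intros bounded_linear_imp_differentiable bounded_linear_vec_nth)
  note pF = pd [OF F]
  show "(\<lambda>x. F (1 + mink_sq t x)) twice_differentiable_on S"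
    unfolding twice_differentiable_on_def
  proof (intro conjI allI)
    show "(\<lambda>x. F (1 + mink_sq t x)) differentiable_on S"
      using dF S differentiable_on_eq_differentiable_at by blast
    fix i
    have "(\<lambda>x. 2 * (eta t i * x $ i) * F' (1 + mink_sq t x)) differentiable_on S"
      using differentiable_mult [OF dc dF'] S differentiable_on_eq_differentiable_at by blast
    then show "partial_deriv i (\<lambda>x. F (1 + mink_sq t x)) differentiable_on S"
      by (rule differentiable_on_cong) (rule pF)
  qed
  assume x: "x \<in> S"
  show "partial_deriv i (\<lambda>x. F (1 + mink_sq t x)) x = 2 * (eta t i * x $ i) * F' (1 + mink_sq t x)"
    by (rule pF [OF x])
  have "partial_deriv i (\<lambda>x. 2 * (eta t i * x $ i)) x = 2 * eta t i" for i
    using partial_deriv_mult [of "\<lambda>x. 2 * eta t i" x "\<lambda>x. x $ i" i]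
    by (simp add: bounded_linear_imp_differentiable [OF bounded_linear_vec_nth]
        partial_deriv_const partial_deriv_coord algebra_simps)
  then have "partial_deriv i (partial_deriv i (\<lambda>x. F (1 + mink_sq t x))) x
      = 2 * (eta t i * x $ i) * (2 * (eta t i * x $ i) * F'' (1 + mink_sq t x))
        + 2 * eta t i * F' (1 + mink_sq t x)" for i
    using partial_deriv_cong [OF S x pF] partial_deriv_mult [OF dc dF' [OF x]] pd [OF F' [OF x]]
    by simp
  moreover have "eta t i * (2 * (eta t i * x $ i) * (2 * (eta t i * x $ i) * a) + 2 * eta t i * b)
      = 4 * (eta t i * x $ i * x $ i) * a + 2 * b" for i a b
    using eta_eta [of t i] by algebra
  ultimately show "dalembertian t (\<lambda>x. F (1 + mink_sq t x)) x
      = 4 * mink_sq t x * F'' (1 + mink_sq t x) + 2 * real CARD('n) * F' (1 + mink_sq t x)"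
    by (simp add: dalembertian_def mink_sq_def mink_inner_def sum.distrib sum_distrib_left sum_distrib_right)
qed

text \<open>The gradient of a function of \<open>x^2\<close> points along \<open>x\<close>, so the
  cross term of the product rule is a multiple of the Euler operator; the two metric factors cancel
  by \<open>eta_eta\<close>.\<close>

lemma dalembertian_radial_mult:
  fixes F F' F'' :: "real \<Rightarrow> real" and t :: "'n::finite"
  assumes S: "open S"
    and F: "\<And>x. x \<in> S \<Longrightarrow> (F has_real_derivative F' (1 + mink_sq t x)) (at (1 + mink_sq t x))"
    and F': "\<And>x. x \<in> S \<Longrightarrow> (F' has_real_derivative F'' (1 + mink_sq t x)) (at (1 + mink_sq t x))"
    and f: "f twice_differentiable_on S" and h: "\<And>x. x \<in> S \<Longrightarrow> dalembertian t f x = 0"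
    and x: "x \<in> S"
  shows "dalembertian t (\<lambda>x. F (1 + mink_sq t x) * f x) x
    = 4 * F' (1 + mink_sq t x) * euler f x
      + (4 * mink_sq t x * F'' (1 + mink_sq t x) + 2 * real CARD('n) * F' (1 + mink_sq t x)) * f x"
proof -
  have *: "eta t i * (2 * (eta t i * x $ i) * a * b) = 2 * a * (x $ i * b)" for i a b
    using eta_eta [of t i] by algebra
  have "(\<Sum>i\<in>UNIV. eta t i * (partial_deriv i (\<lambda>x. F (1 + mink_sq t x)) x * partial_deriv i f x))
      = 2 * F' (1 + mink_sq t x) * euler f x"
    by (simp only: partial_deriv_radial [where F = F and F' = F' and F'' = F'', OF S F F' x]
        euler_def sum_distrib_left *)
  then show ?thesis
    using dalembertian_mult [OF S twice_differentiable_on_radial [where F = F and F' = F' and F'' = F'', OF S F F'] f x, of t]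
      dalembertian_radial [where F = F and F' = F' and F'' = F'', OF S F F' x] h [OF x]
    by simp
qed

subsection \<open>Star-shaped domains\<close>

lemma star_scale_mem:
  assumes "\<And>x. x \<in> S \<Longrightarrow> closed_segment 0 x \<subseteq> S" "x \<in> S" "0 \<le> l" "l \<le> 1"
  shows "l *\<^sub>R x \<in> S"
  using assms by (force simp: closed_segment_def)

text \<open>Along a ray, \<open>2 H f + c f = 0\<close> makes \<open>\<lambda>\<^sup>c f(\<lambda> x)\<^sup>2\<close> independent of \<open>\<lambda>\<close>,
  and this quantity vanishes at \<open>\<lambda> = 0\<close>.\<close>

lemma euler_eigen_zero:
  assumes S: "open S" and star: "\<And>x. x \<in> S \<Longrightarrow> closed_segment 0 x \<subseteq> S"
    and f: "f differentiable_on S" and c: "0 < c"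
    and eq: "\<And>x. x \<in> S \<Longrightarrow> 2 * euler f x + real c * f x = 0"
    and x: "x \<in> S"
  shows "f x = 0"
proof -
  have mem: "l *\<^sub>R x \<in> S" if "0 \<le> l" "l \<le> 1" for l
    using star_scale_mem [OF star x that] .
  let ?D = "\<lambda>l. frechet_derivative f (at (l *\<^sub>R x)) x"
  have d: "((\<lambda>l. f (l *\<^sub>R x)) has_real_derivative ?D l) (at l)" if "0 \<le> l" "l \<le> 1" for l
  proof -
    have df: "f differentiable at (l *\<^sub>R x)"
      using f S mem [OF that] differentiable_on_eq_differentiable_at by blast
    have "((\<lambda>l. l *\<^sub>R x) has_derivative (\<lambda>h. h *\<^sub>R x)) (at l)"
      by (auto intro!: derivative_eq_intros)
    from has_derivative_compose [OF this frechet_derivative_works [THEN iffD1, OF df]]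
    show ?thesis
      using linear_scale [OF linear_frechet_derivative [OF df]]
      by (simp add: has_field_derivative_def mult_commute_abs)
  qed
  have e: "euler f (l *\<^sub>R x) = l * ?D l" if "0 \<le> l" "l \<le> 1" for l
  proof -
    have "f differentiable at (l *\<^sub>R x)"
      using f S mem [OF that] differentiable_on_eq_differentiable_at by blast
    then show ?thesis
      by (simp add: euler_def frechet_derivative_eq_sum_partial sum_distrib_left mult.assoc)
  qed
  \<comment> \<open>The equation makes \<open>f\<close> scale like \<open>l\<close> to the power
    \<open>- c / 2\<close>; squaring \<open>f\<close> leaves a natural exponent.\<close>
  let ?h = "\<lambda>l. l ^ c * (f (l *\<^sub>R x))\<^sup>2"
  have dh: "(?h has_real_derivative l ^ c * (2 * f (l *\<^sub>R x) * ?D l)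
      + real c * l ^ (c - 1) * (f (l *\<^sub>R x))\<^sup>2) (at l)" if "0 \<le> l" "l \<le> 1" for l
    by (auto intro!: derivative_eq_intros d [OF that] simp: power2_eq_square algebra_simps)
  have zero: "l ^ c * (2 * f (l *\<^sub>R x) * ?D l) + real c * l ^ (c - 1) * (f (l *\<^sub>R x))\<^sup>2 = 0"
    if "0 \<le> l" "l \<le> 1" for l
  proof -
    \<comment> \<open>Since \<open>c > 0\<close>, the subtraction is not truncated. Extracting
      \<open>l ^ (c - 1)\<close> exposes the equation at \<open>l *\<^sub>R x\<close> without
      dividing by \<open>l\<close>, so \<open>l = 0\<close> is included.\<close>
    have "l ^ c = l ^ (c - 1) * l" using c by (metis power_minus_mult)
    then have "l ^ c * (2 * f (l *\<^sub>R x) * ?D l) + real c * l ^ (c - 1) * (f (l *\<^sub>R x))\<^sup>2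
        = l ^ (c - 1) * f (l *\<^sub>R x) * (2 * (l * ?D l) + real c * f (l *\<^sub>R x))"
      by (simp add: power2_eq_square algebra_simps)
    then show ?thesis using eq [OF mem [OF that]] e [OF that] by simp
  qed
  have d0: "(?h has_real_derivative 0) (at l)" if "0 \<le> l" "l \<le> 1" for l
    using dh [OF that] unfolding zero [OF that] .
  have "continuous_on {0..1} ?h"
    by (intro continuous_at_imp_continuous_on ballI DERIV_isCont [OF d0]) auto
  then have "?h 1 = ?h 0"
    by (rule DERIV_isconst_end [rotated]) (use d0 in auto)
  then show ?thesis using c by (simp add: zero_power)
qed

text \<open>If \<open>x^2 = -1\<close>, then \<open>1 + (l x)^2 = 1 - l^2\<close> is nonzero for
  \<open>0 \<le> l < 1\<close>. Hence \<open>x\<close> is a limit, along its own ray, of points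
  where \<open>f\<close> is known to vanish.\<close>

lemma zero_off_light_cone_imp_zero:
  fixes f :: "real ^ 'n::finite \<Rightarrow> real"
  assumes S: "open S" and star: "\<And>x. x \<in> S \<Longrightarrow> closed_segment 0 x \<subseteq> S"
    and f: "continuous_on S f"
    and zero: "\<And>x. x \<in> S \<Longrightarrow> 1 + mink_sq t x \<noteq> 0 \<Longrightarrow> f x = 0"
    and x: "x \<in> S"
  shows "f x = 0"
proof (cases "1 + mink_sq t x = 0")
  case False
  then show ?thesis using zero x by blast
next
  case True
  define l where "l n = 1 - 1 / (real n + 2)" for n
  have l: "0 \<le> l n" "l n < 1" for n by (auto simp: l_def field_simps)
  have sq: "mink_sq t (l n *\<^sub>R x) = (l n)\<^sup>2 * mink_sq t x" for n
    by (simp add: mink_sq_def mink_inner_def sum_distrib_left power2_eq_square algebra_simps)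
  have lt: "(l n)\<^sup>2 < 1" for n
    using l [of n] by (simp add: power_less_one_iff)
  have "mink_sq t x = -1" using True by simp
  then have "1 + mink_sq t (l n *\<^sub>R x) \<noteq> 0" for n
    using sq [of n] lt [of n] by simp
  moreover have mem: "l n *\<^sub>R x \<in> S" for n
    using star_scale_mem [OF star x] l [of n] by simp
  ultimately have z: "f (l n *\<^sub>R x) = 0" for n using zero by blast
  have "l \<longlonglongrightarrow> 1" unfolding l_def by real_asymp
  then have "(\<lambda>n. l n *\<^sub>R x) \<longlonglongrightarrow> 1 *\<^sub>R x" by (intro tendsto_intros)
  then have "(\<lambda>n. f (l n *\<^sub>R x)) \<longlonglongrightarrow> f x"
    using continuous_on_eq_continuous_at [OF S, of f] f x
    by (intro isCont_tendsto_compose [of x f]) simp_all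
  then show ?thesis by (simp add: z LIMSEQ_const_iff)
qed

subsection \<open>Independence of harmonic coefficients\<close>

lemma dalembertian_power_mult:
  fixes t :: "'n::finite"
  assumes S: "open S" and f: "smooth_on S f" and h: "\<And>x. x \<in> S \<Longrightarrow> dalembertian t f x = 0"
    and x: "x \<in> S"
  shows "dalembertian t (\<lambda>x. (1 + mink_sq t x) ^ k * f x) x
    = 2 * real k * (1 + mink_sq t x) ^ (k - 1)
        * (2 * euler f x + (real CARD('n) + 2 * real (k - 1)) * f x)
      - 4 * real k * real (k - 1) * (1 + mink_sq t x) ^ (k - 2) * f x"
proof -
  have "dalembertian t (\<lambda>x. (1 + mink_sq t x) ^ k * f x) x
    = 4 * (real k * (1 + mink_sq t x) ^ (k - 1)) * euler f x
      + (4 * mink_sq t x * (real k * (real (k - 1) * (1 + mink_sq t x) ^ (k - 2)))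
      + 2 * real CARD('n) * (real k * (1 + mink_sq t x) ^ (k - 1))) * f x"
    by (rule dalembertian_radial_mult [where F = "\<lambda>y. y ^ k" and F' = "\<lambda>y. real k * y ^ (k - 1)"
          and F'' = "\<lambda>y. real k * (real (k - 1) * y ^ (k - 2))",
          OF S _ _ smooth_on_imp_twice_differentiable_on [OF f] h x])
      (auto intro!: derivative_eq_intros simp: numeral_2_eq_2)
  \<comment> \<open>Writing \<open>x^2 = s - 1\<close> leaves only powers of \<open>s\<close>. The
    factor \<open>real (k - 1)\<close> is zero for \<open>k \<le> 1\<close>, exactly where the
    truncated exponents would break the identity.\<close>
  moreover have "real (k - 1) * (1 + mink_sq t x) ^ (k - 1)
      = real (k - 1) * ((1 + mink_sq t x) * (1 + mink_sq t x) ^ (k - 2))"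
    by (cases k; cases "k - 1") auto
  moreover have "d = 2 * i * p * (2 * e + (n + 2 * j) * g) - 4 * i * j * p' * g"
    if "d = 4 * (i * p) * e + (4 * q * (i * (j * p')) + 2 * n * (i * p)) * g" "j * p = j * ((1 + q) * p')"
    for d i j p p' q e g n :: real
    using that by algebra
  ultimately show ?thesis by blast
qed

lemma smooth_on_mink_power:
  assumes S: "open S"
  shows "smooth_on S (\<lambda>x. (1 + mink_sq t x) ^ k)"
proof (induction k)
  case 0
  then show ?case by (simp add: smooth_on_const [OF S])
next
  case (Suc k)
  have "smooth_on S (\<lambda>x. 1 + mink_sq t x)"
    unfolding mink_sq_def mink_inner_def
    by (intro smooth_on_add smooth_on_const smooth_on_sum smooth_on_mult smooth_on_coord S finite)
  then show ?case using Suc smooth_on_mult [OF S] by simp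
qed

text \<open>The induction generalises over the family \<open>T\<close>, because the d'Alembertian of
  the relation is a shorter relation with a new harmonic family \<open>T'\<close>.\<close>

lemma harmonic_top_coefficient_zero:
  fixes t :: "'n::finite"
  assumes S: "open S" and star: "\<And>x. x \<in> S \<Longrightarrow> closed_segment 0 x \<subseteq> S"
    and T: "\<And>k. smooth_on S (T k)" and h: "\<And>k x. x \<in> S \<Longrightarrow> dalembertian t (T k) x = 0"
    and sum: "\<And>x. x \<in> S \<Longrightarrow> (\<Sum>k<Suc m. (1 + mink_sq t x) ^ k * T k x) = 0"
    and x: "x \<in> S"
  shows "T m x = 0"
  using T h sum x
proof (induction m arbitrary: T x)
  case 0
  then show ?case by fastforce
next
  case (Suc m)
  note T = Suc.prems(1) and h = Suc.prems(2) and sum = Suc.prems(3) and x = Suc.prems(4)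
  \<comment> \<open>By \<open>dalembertian_power_mult\<close>, \<open>a k\<close> is what the term
    of index \<open>k + 1\<close> contributes to \<open>s^k\<close>, and \<open>- b k\<close> is
    what the term of index \<open>k + 2\<close> contributes.\<close>
  define a where "a k x = 2 * (real k + 1) * (2 * euler (T (Suc k)) x
    + (real CARD('n) + 2 * real k) * T (Suc k) x)" for k x
  define b where "b k x = 4 * (real k + 2) * (real k + 1) * T (Suc (Suc k)) x" for k x
  \<comment> \<open>For \<open>k = m\<close>, \<open>b k\<close> would involve a coefficient beyond
    the end of the sum. Cutting it off makes the leading coefficient \<open>T' m\<close> equal to
    \<open>a m\<close>.\<close>
  define c where "c k = (if k < m then 1 else 0 :: real)" for k
  define T' where "T' k x = a k x + - c k * b k x" for k x
  have "smooth_on S (T' k)" for k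
    unfolding T'_def [abs_def] a_def b_def
    by (intro smooth_on_add smooth_on_mult smooth_on_const smooth_on_euler S T)
  moreover have "dalembertian t (T' k) y = 0" if y: "y \<in> S" for k y
  proof -
    have tw: "a k twice_differentiable_on S" "b k twice_differentiable_on S"
      unfolding a_def [abs_def] b_def [abs_def]
      by (intro smooth_on_imp_twice_differentiable_on smooth_on_add smooth_on_mult smooth_on_const
          smooth_on_euler S T)+
    have "dalembertian t (a k) y = 0"
      unfolding a_def [abs_def]
      by (simp add: dalembertian_cmult [OF S _ y] dalembertian_add [OF S _ _ y]
          smooth_on_imp_twice_differentiable_on smooth_on_add [OF S] smooth_on_mult [OF S]
          smooth_on_const [OF S] smooth_on_euler [OF S] T h [OF y] harmonic_euler [OF S T y h])
    moreover have "dalembertian t (b k) y = 0"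
      unfolding b_def [abs_def]
      by (simp add: dalembertian_cmult [OF S _ y] smooth_on_imp_twice_differentiable_on T h [OF y])
    moreover have "dalembertian t (\<lambda>x. a k x + - c k * b k x) y
        = dalembertian t (a k) y + - c k * dalembertian t (b k) y"
      by (simp only: dalembertian_cmult [OF S tw(2) y]
          dalembertian_add [OF S tw(1) twice_differentiable_on_mult [OF S twice_differentiable_on_const tw(2)] y])
    ultimately show ?thesis by (simp add: T'_def [abs_def])
  qed
  moreover have "(\<Sum>k<Suc m. (1 + mink_sq t y) ^ k * T' k y) = 0" if y: "y \<in> S" for y
  proof -
    let ?s = "1 + mink_sq t y"
    have "0 = dalembertian t (\<lambda>x. \<Sum>k<Suc (Suc m). (1 + mink_sq t x) ^ k * T k x) y"
      using dalembertian_cong [OF S y sum, where t = t] by (simp add: dalembertian_const)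
    also have "\<dots> = (\<Sum>k<Suc (Suc m). dalembertian t (\<lambda>x. (1 + mink_sq t x) ^ k * T k x) y)"
      by (rule dalembertian_sum [OF S _ _ y])
        (simp_all add: smooth_on_imp_twice_differentiable_on smooth_on_mult [OF S] smooth_on_mink_power [OF S] T)
    also have "\<dots> = (\<Sum>k<Suc (Suc m). 2 * real k * ?s ^ (k - 1)
        * (2 * euler (T k) y + (real CARD('n) + 2 * real (k - 1)) * T k y))
      - (\<Sum>k<Suc (Suc m). 4 * real k * real (k - 1) * ?s ^ (k - 2) * T k y)"
      by (simp only: dalembertian_power_mult [OF S T h y] sum_subtractf)
    \<comment> \<open>The factors \<open>k\<close> and \<open>k (k - 1)\<close> remove the first one
      and the first two terms, so the sums are shifted by one and by two.\<close>
    also have "\<dots> = (\<Sum>k<Suc m. ?s ^ k * a k y) - (\<Sum>k<m. ?s ^ k * b k y)"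
      by (simp add: sum.lessThan_Suc_shift a_def b_def algebra_simps del: sum.lessThan_Suc)
    also have "(\<Sum>k<m. ?s ^ k * b k y) = (\<Sum>k<Suc m. ?s ^ k * (c k * b k y))"
      by (simp add: c_def)
    finally show ?thesis by (simp add: T'_def sum_subtractf algebra_simps del: sum.lessThan_Suc)
  qed
  ultimately have "T' m y = 0" if "y \<in> S" for y using Suc.IH [of T' y] that by blast
  \<comment> \<open>\<open>T' m = a m\<close>, and its factor \<open>2 * (real m + 1)\<close> is
    nonzero; the remaining constant is a positive natural number, as \<open>euler_eigen_zero\<close>
    demands.\<close>
  then have "2 * euler (T (Suc m)) y + real (CARD('n) + 2 * m) * T (Suc m) y = 0" if "y \<in> S" for y
    using that by (force simp: T'_def a_def c_def)
  then show ?case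
    by (intro euler_eigen_zero [where c = "CARD('n) + 2 * m", OF S star smooth_on_imp_differentiable_on [OF T] _ _ x])
      auto
qed

lemma harmonic_coefficients_zero:
  fixes t :: "'n::finite"
  assumes S: "open S" and star: "\<And>x. x \<in> S \<Longrightarrow> closed_segment 0 x \<subseteq> S"
    and T: "\<And>k. smooth_on S (T k)" and h: "\<And>k x. x \<in> S \<Longrightarrow> dalembertian t (T k) x = 0"
    and sum: "\<And>x. x \<in> S \<Longrightarrow> (\<Sum>k<m. (1 + mink_sq t x) ^ k * T k x) = 0"
    and k: "k < m" and x: "x \<in> S"
  shows "T k x = 0"
  using sum k
proof (induction m)
  case 0
  then show ?case by simp
next
  case (Suc m)
  have top: "T m y = 0" if "y \<in> S" for y
    by (rule harmonic_top_coefficient_zero [OF S star T h Suc.prems(1) that])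
  show ?case
  proof (cases "k = m")
    case True
    then show ?thesis using top x by simp
  next
    case False
    then show ?thesis using Suc top by simp
  qed
qed

subsection \<open>The recursion\<close>

lemma inverse_power_has_derivative:
  assumes "y \<noteq> (0::real)"
  shows "((\<lambda>y. 1 / y ^ r) has_real_derivative - real r / y ^ (r + 1)) (at y)"
proof -
  have "((\<lambda>y. inverse (y ^ r)) has_real_derivative
      - (inverse (y ^ r) * (real r * y ^ (r - Suc 0)) * inverse (y ^ r))) (at y)"
    using assms by (intro DERIV_inverse' DERIV_pow) simp
  moreover have "inverse (y ^ r) * (real r * y ^ (r - Suc 0)) * inverse (y ^ r) = real r / y ^ (r + 1)"
    using assms by (cases r) (simp_all add: field_simps)
  ultimately show ?thesis by (simp add: inverse_eq_divide)
qed

text \<open>With \<open>x^2 = s - 1\<close>, the second derivative of \<open>s^(-r)\<close>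
  contributes \<open>- 4 r (r + 1)\<close> to the coefficient of \<open>s^(-r-2)\<close>. Together
  with \<open>n (n + 2)\<close> from the potential this factors as
  \<open>(n - 2 r) (n + 2 r + 2)\<close>.\<close>

lemma dalembertian_inverse_power_mult:
  fixes t :: "'n::finite"
  assumes S: "open S" and f: "f twice_differentiable_on S"
    and h: "\<And>x. x \<in> S \<Longrightarrow> dalembertian t f x = 0"
    and nz: "\<And>x. x \<in> S \<Longrightarrow> 1 + mink_sq t x \<noteq> 0" and x: "x \<in> S"
  shows "(\<lambda>x. f x * (1 / (1 + mink_sq t x) ^ r)) twice_differentiable_on S"
    and "dalembertian t (\<lambda>x. f x * (1 / (1 + mink_sq t x) ^ r)) x
      + real CARD('n) * (real CARD('n) + 2) / (1 + mink_sq t x)\<^sup>2 * (f x * (1 / (1 + mink_sq t x) ^ r))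
    = (real CARD('n) - 2 * real r) * (real CARD('n) + 2 * real r + 2) * f x / (1 + mink_sq t x) ^ (r + 2)
      - 2 * real r * (2 * euler f x + (real CARD('n) - 2 * real r - 2) * f x) / (1 + mink_sq t x) ^ (r + 1)"
proof -
  let ?F = "\<lambda>y::real. 1 / y ^ r" and ?F' = "\<lambda>y::real. - real r / y ^ (r + 1)"
    and ?F'' = "\<lambda>y::real. real r * (real r + 1) / y ^ (r + 2)"
  have F: "(?F has_real_derivative ?F' y) (at y)" "(?F' has_real_derivative ?F'' y) (at y)"
    if "y \<noteq> 0" for y
    using inverse_power_has_derivative [OF that, of r]
      DERIV_cmult [OF inverse_power_has_derivative [OF that, of "r + 1"], of "- real r"]
    by (simp_all add: algebra_simps)
  have eq: "(\<lambda>x. f x * (1 / (1 + mink_sq t x) ^ r)) = (\<lambda>x. ?F (1 + mink_sq t x) * f x)"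
    by (simp add: fun_eq_iff)
  show "(\<lambda>x. f x * (1 / (1 + mink_sq t x) ^ r)) twice_differentiable_on S"
    unfolding eq
    by (rule twice_differentiable_on_mult [OF S twice_differentiable_on_radial
          [where F = ?F and F' = ?F' and F'' = ?F'', OF S F(1) [OF nz] F(2) [OF nz]] f])
  have d: "dalembertian t (\<lambda>x. ?F (1 + mink_sq t x) * f x) x
    = 4 * ?F' (1 + mink_sq t x) * euler f x
      + (4 * mink_sq t x * ?F'' (1 + mink_sq t x) + 2 * real CARD('n) * ?F' (1 + mink_sq t x)) * f x"
    by (rule dalembertian_radial_mult [where F = ?F and F' = ?F' and F'' = ?F'',
          OF S F(1) [OF nz] F(2) [OF nz] f h x])
  define s where "s = 1 + mink_sq t x"
  have s: "s \<noteq> 0" "mink_sq t x = s - 1" using nz [OF x] by (auto simp: s_def)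
  show "dalembertian t (\<lambda>x. f x * (1 / (1 + mink_sq t x) ^ r)) x
      + real CARD('n) * (real CARD('n) + 2) / (1 + mink_sq t x)\<^sup>2 * (f x * (1 / (1 + mink_sq t x) ^ r))
    = (real CARD('n) - 2 * real r) * (real CARD('n) + 2 * real r + 2) * f x / (1 + mink_sq t x) ^ (r + 2)
      - 2 * real r * (2 * euler f x + (real CARD('n) - 2 * real r - 2) * f x) / (1 + mink_sq t x) ^ (r + 1)"
  proof -
    \<comment> \<open>Naming the inverses reduces the claim to a polynomial identity modulo
      \<open>s * u = 1\<close>.\<close>
    define u where "u = inverse s"
    define v where "v = inverse (s ^ r)"
    have su: "s * u = 1" using s by (simp add: u_def)
    have "4 * (- R * (u * v)) * e + (4 * (s - 1) * (R * (R + 1) * (u * u * v)) + 2 * N * (- R * (u * v))) * g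
        + N * (N + 2) * (u * u) * (v * g)
      = (N - 2 * R) * (N + 2 * R + 2) * g * (u * u * v) - 2 * R * (2 * e + (N - 2 * R - 2) * g) * (u * v)"
      for R N e g :: real
      using su by algebra
    from this [of "real r" "euler f x" "real CARD('n)" "f x"] show ?thesis
      unfolding eq d unfolding s(2) u_def v_def
      by (simp add: divide_inverse power_add power2_eq_square mult_ac)
  qed
qed

text \<open>\<open>S\<close> may meet the hypersurface \<open>1 + x^2 = 0\<close>, where the
  equation says nothing; the recursion is still claimed there, since the coefficients are smooth
  across it. Star-shapedness about 0 serves both this extension and the uniqueness of harmonic
  coefficients.\<close>

theorem theorem1:
  fixes t :: "'n::finite"
    and S :: "(real ^ 'n) set"
    and \<phi> :: "real ^ 'n \<Rightarrow> real"
    and P :: "nat \<Rightarrow> real ^ 'n \<Rightarrow> real"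
  assumes even_dim: "even CARD('n)"
    and open_S: "open S"
    and star_S: "\<And>x. x \<in> S \<Longrightarrow> closed_segment 0 x \<subseteq> S"
    and smooth_P: "\<And>r. r \<le> CARD('n) div 2 \<Longrightarrow> smooth_on S (P r)"
    and box_P: "\<And>r x. r \<le> CARD('n) div 2 \<Longrightarrow> x \<in> S \<Longrightarrow> dalembertian t (P r) x = 0"
    and form: "\<And>x. x \<in> S \<Longrightarrow> 1 + mink_sq t x \<noteq> 0 \<Longrightarrow>
      \<phi> x = (\<Sum>r = 0..CARD('n) div 2. P r x * (1 / (1 + mink_sq t x) ^ r))"
    and equation: "\<And>x. x \<in> S \<Longrightarrow> 1 + mink_sq t x \<noteq> 0 \<Longrightarrow>
      dalembertian t \<phi> x + real CARD('n) * (real CARD('n) + 2) / (1 + mink_sq t x)\<^sup>2 * \<phi> x = 0"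
  shows "\<forall>r x. r + 1 \<le> CARD('n) div 2 \<longrightarrow> x \<in> S \<longrightarrow>
      P r x =
        2 * (real r + 1) *
          (2 * euler (P (r + 1)) x + (real CARD('n) - 2 * real r - 4) * P (r + 1) x) /
        ((real CARD('n) - 2 * real r) * (real CARD('n) + 2 * real r + 2))"
proof -
  define n where "n = real CARD('n)"
  define m where "m = CARD('n) div 2"
  have n: "n = 2 * real m" using even_dim by (auto simp: n_def m_def)
  \<comment> \<open>The recursion cleared of its denominator: \<open>Q r\<close> is the total
    coefficient of \<open>1 / s^(r+2)\<close>, fed by \<open>P r\<close> and by
    \<open>P (Suc r)\<close>.\<close>
  define Q where "Q r x = (n - 2 * real r) * (n + 2 * real r + 2) * P r x
    + - 2 * (real r + 1) * (2 * euler (P (Suc r)) x + (n - 2 * real r - 4) * P (Suc r) x)" for r x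
  have Q_zero: "Q r x = 0" if r: "r < m" and x: "x \<in> S" for r x
  proof -
    have smQ: "smooth_on S (Q k)" and hQ: "\<And>x. x \<in> S \<Longrightarrow> dalembertian t (Q k) x = 0" if k: "k < m" for k
    proof -
      have sm: "smooth_on S (P k)" "smooth_on S (P (Suc k))"
        using smooth_P k by (auto simp: m_def)
      have h: "dalembertian t (P k) x = 0" "dalembertian t (P (Suc k)) x = 0" if "x \<in> S" for x
        using box_P k that by (auto simp: m_def)
      show "smooth_on S (Q k)"
        unfolding Q_def [abs_def]
        by (intro smooth_on_add smooth_on_mult smooth_on_const smooth_on_euler open_S sm)
      fix x assume x: "x \<in> S"
      show "dalembertian t (Q k) x = 0"
        unfolding Q_def [abs_def]
        by (subst dalembertian_add [OF open_S _ _ x] dalembertian_cmult [OF open_S _ x],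
            (intro smooth_on_imp_twice_differentiable_on smooth_on_add smooth_on_mult smooth_on_const
            smooth_on_euler open_S sm)+)+
          (simp add: h [OF x] harmonic_euler [OF open_S sm(2) x h(2)])
    qed
    define s where "s x = 1 + mink_sq t x" for x
    define U where "U = S \<inter> {x. s x \<noteq> 0}"
    have "continuous_on S s"
      using smooth_on_mink_power [OF open_S, of t 1] smooth_on_imp_differentiable_on
        differentiable_imp_continuous_on by (fastforce simp: s_def [abs_def])
    then have "open (S \<inter> s -` (- {0}))"
      by (intro continuous_open_preimage open_S open_Compl closed_singleton)
    moreover have "U = S \<inter> s -` (- {0})" by (auto simp: U_def)
    ultimately have U: "open U" by simp
    have US: "U \<subseteq> S" "\<And>x. x \<in> U \<Longrightarrow> 1 + mink_sq t x \<noteq> 0" by (auto simp: U_def s_def)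
    have sum_U: "(\<Sum>k<m. s x ^ (m - Suc k) * Q k x) = 0" if x: "x \<in> U" for x
    proof -
      let ?B = "\<lambda>r. 2 * real r * (2 * euler (P r) x + (n - 2 * real r - 2) * P r x) / s x ^ (r + 1)"
      let ?C = "\<lambda>r. (n - 2 * real r) * (n + 2 * real r + 2) * P r x / s x ^ (r + 2)"
      have P: "P r twice_differentiable_on U" "\<And>x. x \<in> U \<Longrightarrow> dalembertian t (P r) x = 0" if "r \<le> m" for r
        using smooth_P [of r] box_P [of r] that US(1) twice_differentiable_on_subset
          [OF smooth_on_imp_twice_differentiable_on] by (auto simp: m_def)
      note inv = dalembertian_inverse_power_mult [OF U P US(2) x]
      have phi: "\<phi> y = (\<Sum>r\<in>{..m}. P r y * (1 / (1 + mink_sq t y) ^ r))" if "y \<in> U" for y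
        using form [of y] that US by (auto simp: m_def atLeast0AtMost)
      have "0 = dalembertian t \<phi> x + n * (n + 2) / (1 + mink_sq t x)\<^sup>2 * \<phi> x"
        using equation [of x] x US by (auto simp: n_def)
      also have "\<dots> = (\<Sum>r\<in>{..m}. dalembertian t (\<lambda>x. P r x * (1 / (1 + mink_sq t x) ^ r)) x
          + n * (n + 2) / (1 + mink_sq t x)\<^sup>2 * (P r x * (1 / (1 + mink_sq t x) ^ r)))"
        using dalembertian_cong [OF U x phi, where t = t] dalembertian_sum [OF U _ inv(1) x, where A = "{..m}" and t = t]
        by (simp add: phi [OF x] sum.distrib sum_distrib_left)
      also have "\<dots> = (\<Sum>r\<in>{..m}. ?C r - ?B r)"
        unfolding s_def by (intro sum.cong refl inv(2) [folded n_def]) simp_all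
      also have "\<dots> = (\<Sum>r\<in>{..m}. ?C r) - (\<Sum>r\<in>{..m}. ?B r)" by (rule sum_subtractf)
      \<comment> \<open>Evenness of the dimension is used here: \<open>n = 2 m\<close> kills
        \<open>?C m\<close>. In the other sum the factor \<open>r\<close> kills \<open>?B 0\<close>,
        and a shift by one aligns the powers of \<open>s\<close>.\<close>
      also have "(\<Sum>r\<in>{..m}. ?C r) = (\<Sum>r<m. ?C r)"
        by (simp add: lessThan_Suc_atMost [symmetric] n)
      also have "(\<Sum>r\<in>{..m}. ?B r) = (\<Sum>r<m. ?B (Suc r))"
        by (simp add: sum.atMost_shift)
      finally have 0: "(\<Sum>r<m. ?C r - ?B (Suc r)) = 0" by (simp add: sum_subtractf)
      \<comment> \<open>The largest denominator is \<open>s^(m+1)\<close>, at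
        \<open>r = m - 1\<close>; multiplying by it leaves nonnegative powers of
        \<open>s\<close>.\<close>
      have "s x ^ (m - Suc r) * Q r x = s x ^ (m + 1) * (?C r - ?B (Suc r))" if "r < m" for r
      proof -
        have "m + 1 = (m - Suc r) + (r + 2)" using that by simp
        then have "s x ^ (m + 1) = s x ^ (m - Suc r) * s x ^ (r + 2)"
          by (simp only: power_add)
        moreover have "s x \<noteq> 0" using x by (simp add: U_def)
        ultimately show ?thesis by (simp add: Q_def field_simps)
      qed
      then have "(\<Sum>r<m. s x ^ (m - Suc r) * Q r x) = s x ^ (m + 1) * (\<Sum>r<m. ?C r - ?B (Suc r))"
        by (simp add: sum_distrib_left)
      with 0 show ?thesis by simp
    qed
    have sm_sum: "smooth_on S (\<lambda>x. \<Sum>k<m. s x ^ (m - Suc k) * Q k x)"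
      unfolding s_def
      by (intro smooth_on_sum smooth_on_mult smooth_on_mink_power open_S finite_lessThan)
        (simp add: smQ)
    \<comment> \<open>Without denominators the sum is continuous on all of \<open>S\<close>, so its
      vanishing extends from \<open>U\<close>.\<close>
    have "(\<Sum>k<m. s x ^ (m - Suc k) * Q k x) = 0" if "x \<in> S" for x
      by (rule zero_off_light_cone_imp_zero [OF open_S star_S _ _ that, of _ t])
        (use sm_sum smooth_on_imp_differentiable_on differentiable_imp_continuous_on sum_U
          in \<open>auto simp: U_def s_def\<close>)
    then have sum: "(\<Sum>k<m. (1 + mink_sq t x) ^ k * Q (m - Suc k) x) = 0" if "x \<in> S" for x
      using that sum.nat_diff_reindex [of "\<lambda>k. s x ^ (m - Suc k) * Q k x" m]
      by (simp add: s_def)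
    \<comment> \<open>As \<open>r < m\<close>, \<open>m\<close> is positive and
      \<open>m - Suc k\<close> stays below \<open>m\<close> for every \<open>k\<close>, even when
      truncated; so all members of the reindexed family are smooth and harmonic.\<close>
    have "Q (m - Suc (m - Suc r)) x = 0"
      by (rule harmonic_coefficients_zero [where T = "\<lambda>k. Q (m - Suc k)", OF open_S star_S _ _ sum _ x])
        (use r smQ hQ in auto)
    then show ?thesis using r by simp
  qed
  show ?thesis
  proof (intro allI impI)
    fix r x assume "r + 1 \<le> CARD('n) div 2" and x: "x \<in> S"
    then have r: "r < m" by (simp add: m_def)
    \<comment> \<open>\<open>n - 2 r = 2 (m - r)\<close> is positive, which permits dividing
      \<open>Q r x = 0\<close> back into the recursion.\<close>
    then have "n - 2 * real r \<noteq> 0" "n + 2 * real r + 2 \<noteq> 0" by (auto simp: n)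
    then show "P r x =
        2 * (real r + 1) *
          (2 * euler (P (r + 1)) x + (real CARD('n) - 2 * real r - 4) * P (r + 1) x) /
        ((real CARD('n) - 2 * real r) * (real CARD('n) + 2 * real r + 2))"
      using Q_zero [OF r x] unfolding n_def [symmetric]
      by (simp add: Q_def eq_divide_eq) (simp add: algebra_simps)
  qed
qed

end
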